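(* For $1/3<\lambda\leq4\pi^{-2}=0.4052\ldots$ let $\theta_2(\lambda)\in(0,\pi]$ be the unique root (which exists) of the equation $$x(8-\lambda x^2)\sin x+4(\lambda x^2+x^2-4)\sin^2\frac x2-4x^2=0,\qquad 0<x\leq\pi,$$ and let $\theta_2(\lambda)=0$ for $0\leq\lambda\leq1/3$. Then $\theta_2(4\pi^{-2})=\pi$, $q_2(\lambda)=1-\lambda$ for $0\leq\lambda\leq1/3$, and $$q_2(\lambda)=2\sqrt{\Big(\frac{\cos x-1+\lambda x^2/2}{x^2}\Big)^2+\Big(\frac{x-\sin x}{x^2}\Big)^2}\,\bigg|_{x=\theta_2(\lambda)},\qquad \frac13<\lambda\leq\frac{4}{\pi^2}.$$ Moreover, the function $\lambda+q_2(\lambda)$ is strictly increasing for $1/3<\lambda\leq4\pi^{-2}$, and the function $q_2(\lambda)$ is strictly decreasing for $0\leq\lambda\leq4\pi^{-2}$. In particular, $$q_2(1/3)=2/3,\qquad \inf_{\lambda\geq0}q_2(\lambda)=q_2(4\pi^{-2})=2\sup_{x>0}\frac{x-\sin x}{x^2}=\frac2\pi=0.636619\ldots.$$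
   Context: For $\lambda\geq0$, $$q_2(\lambda)=\sup_{x>0}\frac{2!}{x^2}\bigg|e^{ix}-\sum_{k=0}^{1}\frac{(ix)^k}{k!}-\lambda\frac{(ix)^2}{2!}\bigg|.$$ *)

theory Defs
  imports "HOL-Analysis.Analysis"
begin

definition q2 :: "real \<Rightarrow> real" where
  "q2 l = (SUP x\<in>{0<..}. fact 2 / x ^ 2 *
     norm (exp (\<i> * complex_of_real x)
           - (\<Sum>k=0..1. (\<i> * complex_of_real x) ^ k / fact k)
           - complex_of_real l * ((\<i> * complex_of_real x) ^ 2 / fact 2)))"

text \<open>The real supremum in \<^const>\<open>q2\<close> is meaningful: the set is bounded for every parameter value.\<close>

lemma q2_bdd_above:
  fixes l :: real
  shows "bdd_above ((\<lambda>x. fact 2 / x ^ 2 *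
     norm (exp (\<i> * complex_of_real x)
           - (\<Sum>k=0..1. (\<i> * complex_of_real x) ^ k / fact k)
           - complex_of_real l * ((\<i> * complex_of_real x) ^ 2 / fact 2))) ` {0<..})"
proof (rule bdd_aboveI2)
  fix x :: real
  assume "x \<in> {0<..}"
  then have x: "x > 0" by simp
  let ?z = "\<i> * complex_of_real x"
  have "norm (exp ?z - (\<Sum>k\<le>1. ?z ^ k / fact k)) \<le> exp \<bar>Re ?z\<bar> * norm ?z ^ Suc 1 / fact 1"
    by (rule Taylor_exp)
  then have 1: "norm (exp ?z - (\<Sum>k=0..1. ?z ^ k / fact k)) \<le> x ^ 2"
    using x by (simp add: norm_mult power2_eq_square atMost_atLeast0)
  have 2: "norm (complex_of_real l * (?z ^ 2 / fact 2)) = \<bar>l\<bar> * x ^ 2 / 2"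
    by (simp add: norm_mult norm_divide norm_power)
  have "norm (exp ?z - (\<Sum>k=0..1. ?z ^ k / fact k) - complex_of_real l * (?z ^ 2 / fact 2))
      \<le> x ^ 2 + \<bar>l\<bar> * x ^ 2 / 2"
    using norm_triangle_ineq4[of "exp ?z - (\<Sum>k=0..1. ?z ^ k / fact k)"
      "complex_of_real l * (?z ^ 2 / fact 2)"] 1 2 by linarith
  then have "fact 2 / x ^ 2 * norm (exp ?z - (\<Sum>k=0..1. ?z ^ k / fact k)
      - complex_of_real l * (?z ^ 2 / fact 2)) \<le> fact 2 / x ^ 2 * (x ^ 2 + \<bar>l\<bar> * x ^ 2 / 2)"
    by (rule mult_left_mono) simp
  also have "\<dots> = 2 + \<bar>l\<bar>"
    using x by (simp add: field_simps)
  finally show "fact 2 / x ^ 2 * norm (exp ?z - (\<Sum>k=0..1. ?z ^ k / fact k)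
      - complex_of_real l * (?z ^ 2 / fact 2)) \<le> 2 + \<bar>l\<bar>" .
qed

definition theta2_root :: "real \<Rightarrow> real \<Rightarrow> bool" where
  "theta2_root l x \<longleftrightarrow> 0 < x \<and> x \<le> pi \<and>
     x * (8 - l * x ^ 2) * sin x
       + 4 * (l * x ^ 2 + x ^ 2 - 4) * (sin (x / 2)) ^ 2 - 4 * x ^ 2 = 0"

text \<open>Only parameters in \<open>{0..4 / pi ^ 2}\<close> are meaningful here; elsewhere the value is a dummy.\<close>

definition theta2 :: "real \<Rightarrow> real" where
  "theta2 l = (if l \<le> 1 / 3 then 0 else (THE x. theta2_root l x))"

end

theory Submission
  imports Defs "HOL-Real_Asymp.Real_Asymp"
begin

text \<open>
  With \<open>y = x / 2\<close> the expression under the supremum is the square root of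
  \<open>Qq l y = (l - Aq y)\<^sup>2 + (Bq y)\<^sup>2\<close>, where \<open>Aq y = (sin y / y)\<^sup>2\<close> and
  \<open>Bq y = (y - sin y cos y) / y\<^sup>2\<close>. The left side of the equation for \<open>\<theta>\<^sub>2\<close> factors as
  \<open>16 (sin y - y cos y) (l y\<^sup>2 sin y - (sin y - y cos y))\<close> and is, up to a positive factor, the
  derivative of \<open>Qq l\<close>. Hence on \<open>(0, \<pi>)\<close> the sign of that derivative is the sign of \<open>l - Rq y\<close>,
  where \<open>Rq y = (1 - y cot y) / y\<^sup>2\<close> increases strictly, with limit \<open>1/3\<close> at \<open>0\<close> and value
  \<open>4/\<pi>\<^sup>2\<close> at \<open>\<pi>/2\<close>. So \<open>Qq l\<close> is maximal over \<open>(0, \<pi>)\<close> at the root, or at \<open>0+\<close> if \<open>l \<le> 1/3\<close>;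
  for \<open>y \<ge> \<pi>\<close> crude bounds give \<open>Qq l y \<le> 4/\<pi>\<^sup>2 \<le> Qq l (\<pi>/2)\<close>.

  For monotonicity, compare \<open>Qq l\<close> and \<open>Qq l'\<close> at the maximiser of one of them: \<open>l + \<surd>Qq l y\<close>
  increases strictly in \<open>l\<close> because \<open>Bq y > 0\<close>, and \<open>Qq l y\<close> decreases strictly in
  \<open>l \<le> 4/\<pi>\<^sup>2\<close> because \<open>Aq y \<ge> 4/\<pi>\<^sup>2\<close> for \<open>y \<le> \<pi>/2\<close>.
\<close>

section \<open>The expression under the supremum in the half variable\<close>

definition Aq :: "real \<Rightarrow> real" where
  "Aq y = (sin y / y) ^ 2"

definition Bq :: "real \<Rightarrow> real" where
  "Bq y = (y - sin y * cos y) / y ^ 2"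

definition Qq :: "real \<Rightarrow> real \<Rightarrow> real" where
  "Qq l y = (l - Aq y) ^ 2 + (Bq y) ^ 2"

definition Rq :: "real \<Rightarrow> real" where
  "Rq y = (sin y - y * cos y) / (y ^ 2 * sin y)"

lemma Aq_half: "x \<noteq> 0 \<Longrightarrow> Aq (x / 2) = 2 * (1 - cos x) / x ^ 2"
  using cos_double_sin[of "x / 2"] by (simp add: Aq_def power_divide)

lemma Bq_half: "x \<noteq> 0 \<Longrightarrow> Bq (x / 2) = 2 * (x - sin x) / x ^ 2"
  using sin_double[of "x / 2"] by (simp add: Bq_def power2_eq_square field_simps)

text \<open>The right side is both the closed formula of the theorem and the expression under the
  supremum in \<open>q2\<close>, so this identity serves at both places.\<close>

lemma sqrt_Qq_half:
  assumes "x \<noteq> 0"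
  shows "sqrt (Qq l (x / 2)) =
    2 * sqrt (((cos x - 1 + l * x ^ 2 / 2) / x ^ 2) ^ 2 + ((x - sin x) / x ^ 2) ^ 2)"
proof -
  have "l - Aq (x / 2) = 2 * ((cos x - 1 + l * x ^ 2 / 2) / x ^ 2)"
    using assms by (simp add: Aq_half field_simps)
  moreover have "Bq (x / 2) = 2 * ((x - sin x) / x ^ 2)"
    using assms by (simp add: Bq_half)
  ultimately have "Qq l (x / 2) =
      2 ^ 2 * (((cos x - 1 + l * x ^ 2 / 2) / x ^ 2) ^ 2 + ((x - sin x) / x ^ 2) ^ 2)"
    unfolding Qq_def by (simp only: power_mult_distrib distrib_left)
  then show ?thesis
    by (simp only: real_sqrt_mult real_sqrt_abs)
qed

text \<open>Since \<open>(i x)^2 = -x^2\<close>, the remainder has real part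
  \<open>cos x - 1 + l * x ^ 2 / 2\<close> and imaginary part \<open>sin x - x\<close>.\<close>

lemma q2_summand:
  assumes "x > 0"
  shows "fact 2 / x ^ 2 *
     norm (exp (\<i> * complex_of_real x)
           - (\<Sum>k=0..1. (\<i> * complex_of_real x) ^ k / fact k)
           - complex_of_real l * ((\<i> * complex_of_real x) ^ 2 / fact 2)) = sqrt (Qq l (x / 2))"
proof -
  let ?u = "cos x - 1 + l * x ^ 2 / 2" and ?v = "x - sin x"
  have "exp (\<i> * complex_of_real x)
           - (\<Sum>k=0..1. (\<i> * complex_of_real x) ^ k / fact k)
           - complex_of_real l * ((\<i> * complex_of_real x) ^ 2 / fact 2) = Complex ?u (- ?v)"
    by (simp add: complex_eq_iff Re_exp Im_exp power2_eq_square)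
  then have "fact 2 / x ^ 2 *
     norm (exp (\<i> * complex_of_real x)
           - (\<Sum>k=0..1. (\<i> * complex_of_real x) ^ k / fact k)
           - complex_of_real l * ((\<i> * complex_of_real x) ^ 2 / fact 2))
      = 2 * (sqrt (?u ^ 2 + ?v ^ 2) / x ^ 2)"
    by (simp add: cmod_def power2_commute)
  also have "\<dots> = 2 * sqrt ((?u / x ^ 2) ^ 2 + (?v / x ^ 2) ^ 2)"
  proof -
    have "(?u / x ^ 2) ^ 2 + (?v / x ^ 2) ^ 2 = (?u ^ 2 + ?v ^ 2) / (x ^ 2) ^ 2"
      by (simp only: power_divide flip: add_divide_distrib)
    then show ?thesis by (simp only: real_sqrt_divide real_sqrt_abs) simp
  qed
  finally show ?thesis
    using assms by (simp add: sqrt_Qq_half)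
qed

lemma sqrt_Qq_le_q2:
  assumes "y > 0"
  shows "sqrt (Qq l y) \<le> q2 l"
proof -
  have "2 * y \<in> {0<..}" using assms by simp
  from cSUP_upper[OF this q2_bdd_above, of l] show ?thesis
    using q2_summand[of "2 * y" l] assms by (simp add: q2_def)
qed

lemma q2_le:
  assumes "\<And>y. y > 0 \<Longrightarrow> sqrt (Qq l y) \<le> b"
  shows "q2 l \<le> b"
  unfolding q2_def
proof (rule cSUP_least)
  fix x :: real
  assume "x \<in> {0<..}"
  then show "fact 2 / x ^ 2 *
     norm (exp (\<i> * complex_of_real x)
           - (\<Sum>k=0..1. (\<i> * complex_of_real x) ^ k / fact k)
           - complex_of_real l * ((\<i> * complex_of_real x) ^ 2 / fact 2)) \<le> b"
    using q2_summand[of x l] assms[of "x / 2"] by simp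
qed simp

section \<open>Monotonicity, limit and range of \<open>Rq\<close>\<close>

lemma mult_cos_less_sin:
  fixes y :: real
  assumes "0 < y" "y < pi"
  shows "y * cos y < sin y"
proof -
  have "(\<lambda>t::real. sin t - t * cos t) 0 < (\<lambda>t. sin t - t * cos t) y"
  proof (rule DERIV_pos_imp_increasing_open[OF assms(1)])
    fix t :: real
    assume t: "0 < t" "t < y"
    have "((\<lambda>t. sin t - t * cos t) has_real_derivative t * sin t) (at t)"
      by (auto intro!: derivative_eq_intros)
    moreover have "t * sin t > 0" using t assms by (simp add: sin_gt_zero)
    ultimately show "\<exists>d. ((\<lambda>t. sin t - t * cos t) has_real_derivative d) (at t) \<and> d > 0" by blast
  qed (auto intro!: continuous_intros)
  then show ?thesis by simp
qed

text \<open>This is the numerator of the derivative of \<open>Rq\<close> after a factor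
  \<open>y\<close> cancels. It vanishes at 0, and so does its derivative \<open>g\<close>. The
  derivative of \<open>g\<close> is \<open>4 * sin u * (sin u - u * cos u)\<close>, positive by
  \<open>mult_cos_less_sin\<close>, so two steps up from 0 suffice.\<close>

lemma Rq_deriv_numerator_pos:
  fixes y :: real
  assumes "0 < y" "y < pi"
  shows "y ^ 2 + y * sin y * cos y - 2 * sin y ^ 2 > 0"
proof -
  define g where "g t = 2 * t + t * (cos t ^ 2 - sin t ^ 2) - 3 * (sin t * cos t)" for t :: real
  have g_pos: "g t > 0" if t: "0 < t" "t < pi" for t
  proof -
    have "g 0 < g t"
    proof (rule DERIV_pos_imp_increasing_open[OF t(1)])
      fix u :: real
      assume u: "0 < u" "u < t"
      have "2 + (cos u ^ 2 - sin u ^ 2 - 4 * u * sin u * cos u) - 3 * (cos u ^ 2 - sin u ^ 2)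
          = 4 * sin u * (sin u - u * cos u)"
        using sin_cos_squared_add[of u] by algebra
      moreover have "(g has_real_derivative
          2 + (cos u ^ 2 - sin u ^ 2 - 4 * u * sin u * cos u) - 3 * (cos u ^ 2 - sin u ^ 2)) (at u)"
        unfolding g_def
        by (auto intro!: derivative_eq_intros simp: power2_eq_square)
      ultimately have "(g has_real_derivative 4 * sin u * (sin u - u * cos u)) (at u)"
        by simp
      moreover have "4 * sin u * (sin u - u * cos u) > 0"
        using u t mult_cos_less_sin[of u] by (simp add: sin_gt_zero)
      ultimately show "\<exists>d. (g has_real_derivative d) (at u) \<and> d > 0" by blast
    qed (auto simp: g_def intro!: continuous_intros)
    then show ?thesis by (simp add: g_def)
  qed
  define k where "k t = t ^ 2 + t * sin t * cos t - 2 * sin t ^ 2" for t :: real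
  have "k 0 < k y"
  proof (rule DERIV_pos_imp_increasing_open[OF assms(1)])
    fix u :: real
    assume u: "0 < u" "u < y"
    have "(k has_real_derivative g u) (at u)"
      unfolding g_def k_def
      by (auto intro!: derivative_eq_intros) algebra
    with g_pos[of u] u assms show "\<exists>d. (k has_real_derivative d) (at u) \<and> d > 0" by auto
  qed (auto simp: k_def intro!: continuous_intros)
  then show ?thesis by (simp add: k_def)
qed

lemma Rq_has_derivative:
  assumes "0 < y" "y < pi"
  shows "(Rq has_real_derivative
    (y ^ 2 + y * sin y * cos y - 2 * sin y ^ 2) / (y ^ 3 * sin y ^ 2)) (at y)"
proof -
  have s: "sin y \<noteq> 0" using assms by (simp add: sin_gt_zero less_imp_neq[symmetric])
  have "(Rq has_real_derivative
     ((y * sin y) * (y ^ 2 * sin y) - (sin y - y * cos y) * (2 * y * sin y + y ^ 2 * cos y))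
       / (y ^ 2 * sin y) ^ 2) (at y)"
    unfolding Rq_def using assms s
    by (auto intro!: derivative_eq_intros simp: power2_eq_square algebra_simps)
  also have "(y * sin y) * (y ^ 2 * sin y) - (sin y - y * cos y) * (2 * y * sin y + y ^ 2 * cos y)
      = y * (y ^ 2 + y * sin y * cos y - 2 * sin y ^ 2)"
    using sin_cos_squared_add[of y] by algebra
  also have "\<dots> / (y ^ 2 * sin y) ^ 2 =
      (y ^ 2 + y * sin y * cos y - 2 * sin y ^ 2) / (y ^ 3 * sin y ^ 2)"
    using assms s by (simp add: field_simps eval_nat_numeral)
  finally show ?thesis .
qed

lemma Rq_strict_mono:
  assumes "0 < a" "a < b" "b < pi"
  shows "Rq a < Rq b"
proof (rule DERIV_pos_imp_increasing[OF assms(2)])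
  fix y :: real
  assume y: "a \<le> y" "y \<le> b"
  have "(y ^ 2 + y * sin y * cos y - 2 * sin y ^ 2) / (y ^ 3 * sin y ^ 2) > 0"
    using y assms Rq_deriv_numerator_pos[of y] sin_gt_zero[of y] by (intro divide_pos_pos) auto
  with Rq_has_derivative[of y] y assms
  show "\<exists>d. (Rq has_real_derivative d) (at y) \<and> d > 0" by auto
qed

lemma Rq_tendsto: "(Rq \<longlongrightarrow> 1 / 3) (at_right 0)"
  unfolding Rq_def by real_asymp

lemma Rq_gt:
  assumes "0 < y" "y < pi"
  shows "1 / 3 < Rq y"
proof -
  \<comment> \<open>The limit alone gives a weak inequality; the detour through \<open>y / 2\<close>
    makes it strict.\<close>
  have "1 / 3 \<le> Rq (y / 2)"
  proof (rule tendsto_upperbound[OF Rq_tendsto])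
    have "\<forall>\<^sub>F t in at_right 0. 0 < t \<and> t < y / 2"
      using assms by (auto simp: eventually_at_right_field intro!: exI[of _ "y / 2"])
    then show "\<forall>\<^sub>F t in at_right 0. Rq t \<le> Rq (y / 2)"
      by eventually_elim (use assms in \<open>auto intro!: less_imp_le Rq_strict_mono\<close>)
  qed simp
  also have "\<dots> < Rq y" using assms by (intro Rq_strict_mono) auto
  finally show ?thesis .
qed

lemma Rq_pi_half: "Rq (pi / 2) = 4 / pi ^ 2"
  by (simp add: Rq_def power_divide)

text \<open>Intermediate value theorem: the limit \<open>1 / 3 < l\<close> forces \<open>Rq\<close>
  below \<open>l\<close> near 0, and \<open>Rq (pi / 2)\<close> is the largest admissible
  \<open>l\<close>.\<close>

lemma Rq_surj:
  assumes "1 / 3 < l" "l \<le> 4 / pi ^ 2"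
  obtains y where "0 < y" "y \<le> pi / 2" "Rq y = l"
proof -
  have "\<forall>\<^sub>F t in at_right 0. Rq t < l"
    using Rq_tendsto assms(1) by (rule order_tendstoD(2))
  then obtain b where b: "b > 0" "\<And>t. 0 < t \<Longrightarrow> t < b \<Longrightarrow> Rq t < l"
    by (auto simp: eventually_at_right_field)
  \<comment> \<open>Halving keeps \<open>a\<close> strictly below \<open>b\<close>, as the bound on
    \<open>Rq a\<close> requires.\<close>
  define a where "a = min b (pi / 2) / 2"
  have "min b (pi / 2) \<le> pi / 2" "min b (pi / 2) \<le> b" "0 < min b (pi / 2)"
    using b(1) by simp_all
  then have a: "0 < a" "a < b" "a \<le> pi / 2" unfolding a_def by linarith+
  have "\<exists>y. a \<le> y \<and> y \<le> pi / 2 \<and> Rq y = l"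
  proof (rule IVT)
    show "Rq a \<le> l" using b(2)[OF a(1,2)] by simp
    show "l \<le> Rq (pi / 2)" using assms by (simp add: Rq_pi_half)
    show "\<forall>y. a \<le> y \<and> y \<le> pi / 2 \<longrightarrow> isCont Rq y"
    proof (intro allI impI)
      fix y assume "a \<le> y \<and> y \<le> pi / 2"
      then have "0 < y" "y < pi" using a(1) pi_gt_zero by linarith+
      then show "isCont Rq y" by (rule DERIV_isCont[OF Rq_has_derivative])
    qed
  qed (use a in simp)
  then obtain y where "a \<le> y" "y \<le> pi / 2" "Rq y = l" by blast
  with a(1) show ?thesis by (intro that) simp_all
qed

section \<open>Roots of the equation for \<open>theta2\<close>\<close>

lemma theta2_root_iff: "theta2_root l x \<longleftrightarrow> 0 < x \<and> x \<le> pi \<and> Rq (x / 2) = l"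
proof (cases "0 < x \<and> x \<le> pi")
  case True
  define y where "y = x / 2"
  have x: "x = 2 * y" and y: "0 < y" "y < pi" using True by (auto simp: y_def)
  have s: "sin y > 0" using y by (rule sin_gt_zero)
  have d: "sin y - y * cos y > 0" using mult_cos_less_sin[OF y] by simp
  have "x * (8 - l * x ^ 2) * sin x
       + 4 * (l * x ^ 2 + x ^ 2 - 4) * (sin (x / 2)) ^ 2 - 4 * x ^ 2
     = 16 * (sin y - y * cos y) * (l * (y ^ 2 * sin y) - (sin y - y * cos y))"
  proof -
    have "2 * y * (8 - l * (2 * y) ^ 2) * (2 * sin y * cos y)
       + 4 * (l * (2 * y) ^ 2 + (2 * y) ^ 2 - 4) * (sin y) ^ 2 - 4 * (2 * y) ^ 2
     = 16 * (sin y - y * cos y) * (l * (y ^ 2 * sin y) - (sin y - y * cos y))"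
      using sin_cos_squared_add[of y] by algebra
    then show ?thesis by (simp add: x sin_double)
  qed
  \<comment> \<open>The factor \<open>sin y - y * cos y\<close> is positive, so only the last factor
    can vanish.\<close>
  also have "\<dots> = 0 \<longleftrightarrow> l * (y ^ 2 * sin y) = sin y - y * cos y"
    using d by simp
  also have "\<dots> \<longleftrightarrow> Rq y = l"
    using y s by (auto simp: Rq_def divide_eq_eq)
  finally show ?thesis using True by (auto simp: theta2_root_def y_def)
qed (auto simp: theta2_root_def)

lemma theta2_root_unique: "theta2_root l x \<Longrightarrow> theta2_root l x' \<Longrightarrow> x = x'"
  using Rq_strict_mono[of "x / 2" "x' / 2"] Rq_strict_mono[of "x' / 2" "x / 2"]
  by (cases x x' rule: linorder_cases) (auto simp: theta2_root_iff)

lemma ex1_theta2_root: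
  assumes "1 / 3 < l" "l \<le> 4 / pi ^ 2"
  shows "\<exists>!x. theta2_root l x"
proof -
  obtain y where "0 < y" "y \<le> pi / 2" "Rq y = l" using Rq_surj[OF assms] .
  then have "theta2_root l (2 * y)" by (simp add: theta2_root_iff)
  then show ?thesis using theta2_root_unique by blast
qed

lemma theta2_eqI:
  assumes "1 / 3 < l" "theta2_root l x"
  shows "theta2 l = x"
  using assms theta2_root_unique by (auto simp: theta2_def intro!: the_equality)

section \<open>Monotonicity of \<open>Qq l\<close> in \<open>y\<close> on
  \<open>(0, pi)\<close>\<close>

lemma Aq_has_derivative:
  assumes "y \<noteq> 0"
  shows "(Aq has_real_derivative - (2 * sin y * (sin y - y * cos y) / y ^ 3)) (at y)"
  unfolding Aq_def using assms
  by (auto intro!: derivative_eq_intros simp: field_simps eval_nat_numeral)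

text \<open>The derivatives of \<open>Aq\<close> and \<open>Bq\<close> are \<open>- sin y\<close>
  and \<open>cos y\<close> times the common factor \<open>2 * (sin y - y * cos y) / y ^ 3\<close>.
  The rest is the identity \<open>Aq y * sin y - Bq y * cos y = sin y * Rq y\<close>.\<close>

lemma Qq_has_derivative:
  assumes "0 < y" "y < pi"
  shows "(Qq l has_real_derivative
    4 * (sin y - y * cos y) * sin y / y ^ 3 * (l - Rq y)) (at y)"
proof -
  have s: "sin y \<noteq> 0" using assms by (simp add: sin_gt_zero less_imp_neq[symmetric])
  have A: "(Aq has_real_derivative - (2 * sin y * (sin y - y * cos y) / y ^ 3)) (at y)"
    using assms by (intro Aq_has_derivative) simp
  have "(Bq has_real_derivative
      ((1 - (cos y ^ 2 - sin y ^ 2)) * y ^ 2 - (y - sin y * cos y) * (2 * y)) / (y ^ 2) ^ 2) (at y)"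
    unfolding Bq_def using assms
    by (auto intro!: derivative_eq_intros simp: power2_eq_square algebra_simps)
  also have "(1 - (cos y ^ 2 - sin y ^ 2)) * y ^ 2 - (y - sin y * cos y) * (2 * y)
      = y * (2 * cos y * (sin y - y * cos y))"
    using sin_cos_squared_add[of y] by algebra
  also have "\<dots> / (y ^ 2) ^ 2 = 2 * cos y * (sin y - y * cos y) / y ^ 3"
    using assms by (simp add: field_simps eval_nat_numeral)
  finally have B: "(Bq has_real_derivative 2 * cos y * (sin y - y * cos y) / y ^ 3) (at y)" .
  have "((\<lambda>t. (l - f t) ^ 2 + (g t) ^ 2) has_real_derivative
      2 * (l - f y) * (- f') + 2 * g y * g') (at y)"
    if "(f has_real_derivative f') (at y)" "(g has_real_derivative g') (at y)" for f g f' g'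
    by (auto intro!: derivative_eq_intros that)
  from this[OF A B] have "(Qq l has_real_derivative
     2 * (l - Aq y) * (2 * sin y * (sin y - y * cos y) / y ^ 3)
     + 2 * Bq y * (2 * cos y * (sin y - y * cos y) / y ^ 3)) (at y)"
    by (simp only: Qq_def[abs_def] minus_minus)
  also have "2 * (l - Aq y) * (2 * sin y * (sin y - y * cos y) / y ^ 3)
     + 2 * Bq y * (2 * cos y * (sin y - y * cos y) / y ^ 3)
     = 4 * (sin y - y * cos y) / y ^ 3 * ((l - Aq y) * sin y + Bq y * cos y)"
  proof -
    have "2 * a * (2 * s * d / e) + 2 * b * (2 * c * d / e) = 4 * d / e * (a * s + b * c)"
      for a b c d e s :: real
      by (simp add: algebra_simps add_divide_distrib)
    then show ?thesis .
  qed
  also have "(l - Aq y) * sin y + Bq y * cos y = sin y * (l - Rq y)"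
  proof -
    have "sin y * Rq y = (sin y - y * cos y) / y ^ 2"
      using s by (simp add: Rq_def)
    \<comment> \<open>Inserting this factor 1 lets the quotient split into its \<open>Aq\<close> and
      \<open>Bq\<close> terms.\<close>
    also have "sin y = sin y * (sin y ^ 2 + cos y ^ 2)"
      by simp
    also have "(\<dots> - y * cos y) / y ^ 2 = Aq y * sin y - Bq y * cos y"
    proof -
      have "(u * (u ^ 2 + v ^ 2) - y * v) / y ^ 2 = (u / y) ^ 2 * u - (y - u * v) / y ^ 2 * v"
        for u v :: real
        by (simp add: power_divide add_divide_distrib diff_divide_distrib power2_eq_square
            algebra_simps)
      then show ?thesis by (simp only: Aq_def Bq_def)
    qed
    finally show ?thesis by (simp add: algebra_simps)
  qed
  finally show ?thesis by (simp add: mult_ac)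
qed

lemma Qq_less_increasing:
  assumes "0 < a" "a < b" "b < pi" "Rq b \<le> l"
  shows "Qq l a < Qq l b"
proof (rule DERIV_pos_imp_increasing_open[OF assms(2)])
  fix y :: real
  assume y: "a < y" "y < b"
  have "Rq y < l" using Rq_strict_mono[of y b] y assms by simp
  then have "4 * (sin y - y * cos y) * sin y / y ^ 3 * (l - Rq y) > 0"
    using y assms mult_cos_less_sin[of y] sin_gt_zero[of y] by simp
  with Qq_has_derivative[of y l] y assms
  show "\<exists>d. (Qq l has_real_derivative d) (at y) \<and> d > 0" by auto
next
  show "continuous_on {a..b} (Qq l)"
    using assms
    by (intro continuous_at_imp_continuous_on ballI DERIV_isCont[OF Qq_has_derivative]) auto
qed

lemma Qq_less_decreasing:
  assumes "0 < a" "a < b" "b < pi" "l \<le> Rq a"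
  shows "Qq l b < Qq l a"
proof (rule DERIV_neg_imp_decreasing_open[OF assms(2)])
  fix y :: real
  assume y: "a < y" "y < b"
  have "l < Rq y" using Rq_strict_mono[of a y] y assms by simp
  then have "4 * (sin y - y * cos y) * sin y / y ^ 3 * (l - Rq y) < 0"
    using y assms mult_cos_less_sin[of y] sin_gt_zero[of y] by (intro mult_pos_neg) auto
  with Qq_has_derivative[of y l] y assms
  show "\<exists>d. (Qq l has_real_derivative d) (at y) \<and> d < 0" by auto
next
  show "continuous_on {a..b} (Qq l)"
    using assms
    by (intro continuous_at_imp_continuous_on ballI DERIV_isCont[OF Qq_has_derivative]) auto
qed

section \<open>Maximum of \<open>Qq l\<close> and the value of \<open>q2\<close>\<close>

lemma Aq_pi_half: "Aq (pi / 2) = 4 / pi ^ 2"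
  by (simp add: Aq_def power_divide)

lemma Bq_pi_half: "Bq (pi / 2) = 2 / pi"
  by (simp add: Bq_def power2_eq_square)

lemma Qq_pi_half_ge: "4 / pi ^ 2 \<le> Qq l (pi / 2)"
  by (simp add: Qq_def Bq_pi_half power_divide)

text \<open>Both \<open>l - Aq y\<close> and \<open>Bq y\<close> are at most
  \<open>(4 / 3) / pi\<close> in absolute value, and \<open>2 * (4 / 3)^2 = 32 / 9 < 4\<close>. The
  constant \<open>4 / 3\<close> comes from \<open>pi > 3\<close>, which gives
  \<open>1 / pi + 1 / pi ^ 2 \<le> (1 + 1 / 3) / pi\<close>.\<close>

lemma Qq_le_beyond_pi:
  assumes "0 \<le> l" "l \<le> 4 / pi ^ 2" "y \<ge> pi"
  shows "Qq l y \<le> 4 / pi ^ 2"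
proof -
  have pi3: "pi > 3" by (rule pi_gt3)
  have y: "y > 0" using assms pi3 by simp
  have "Aq y \<le> 1 / pi ^ 2"
  proof -
    have "sin y ^ 2 / y ^ 2 \<le> 1 / pi ^ 2"
      using assms by (intro frac_le power_mono) (auto simp: abs_square_le_1)
    then show ?thesis by (simp add: Aq_def power_divide)
  qed
  moreover have "0 \<le> Aq y" by (simp add: Aq_def)
  moreover have "1 / pi ^ 2 \<le> 4 / pi ^ 2" by (simp add: divide_right_mono)
  ultimately have "\<bar>l - Aq y\<bar> \<le> 4 / pi ^ 2" using assms by linarith
  also have "4 / pi ^ 2 \<le> (4 / 3) / pi" using pi3 by (simp add: field_simps power2_eq_square)
  finally have 1: "(l - Aq y) ^ 2 \<le> ((4 / 3) / pi) ^ 2"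
    by (rule power2_le_iff_abs_le[THEN iffD2, rotated]) simp
  have "\<bar>sin y * cos y\<bar> \<le> 1"
    unfolding abs_mult by (rule mult_le_one) auto
  then have "\<bar>Bq y\<bar> \<le> (y + 1) / y ^ 2"
    using y by (simp add: Bq_def divide_right_mono)
  also have "\<dots> = 1 / y + 1 / y ^ 2"
    using y by (simp add: field_simps power2_eq_square)
  also have "\<dots> \<le> 1 / pi + 1 / pi ^ 2"
    using assms by (intro add_mono frac_le power_mono) auto
  also have "\<dots> \<le> (4 / 3) / pi" using pi3 by (simp add: field_simps power2_eq_square)
  finally have 2: "(Bq y) ^ 2 \<le> ((4 / 3) / pi) ^ 2"
    by (rule power2_le_iff_abs_le[THEN iffD2, rotated]) simp
  have "Qq l y \<le> 2 * ((4 / 3) / pi) ^ 2" using 1 2 by (simp add: Qq_def)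
  also have "\<dots> \<le> 4 / pi ^ 2" by (simp add: power_divide field_simps)
  finally show ?thesis .
qed

text \<open>On \<open>(0, pi)\<close> the function \<open>Qq l\<close> rises up to \<open>z\<close>
  and falls afterwards; points from \<open>pi\<close> on are compared with \<open>z\<close> through
  \<open>pi / 2\<close>.\<close>

lemma Qq_le_of_Rq_eq:
  assumes l: "0 \<le> l" "l \<le> 4 / pi ^ 2" and z: "0 < z" "z \<le> pi / 2" "Rq z = l" and y: "0 < y"
  shows "Qq l y \<le> Qq l z"
proof (cases "y < pi")
  case True
  then show ?thesis
    using Qq_less_increasing[of y z l] Qq_less_decreasing[of z y l] z y
    by (cases y z rule: linorder_cases) auto
next
  case False
  then have "Qq l y \<le> Qq l (pi / 2)"
    using Qq_le_beyond_pi[OF l, of y] Qq_pi_half_ge[of l] by simp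
  also have "\<dots> \<le> Qq l z"
    using Qq_less_decreasing[of z "pi / 2" l] z by (cases "z = pi / 2") (auto simp only: order_refl, simp)
  finally show ?thesis .
qed

lemma q2_eq_of_Rq_eq:
  assumes "0 \<le> l" "l \<le> 4 / pi ^ 2" "0 < z" "z \<le> pi / 2" "Rq z = l"
  shows "q2 l = sqrt (Qq l z)"
  using assms by (intro antisym q2_le sqrt_Qq_le_q2) (auto intro: Qq_le_of_Rq_eq)

lemma one_third_less: "1 / 3 < 4 / pi ^ 2"
  using Rq_gt[of "pi / 2"] by (simp add: Rq_pi_half)

text \<open>Here \<open>l \<le> 1 / 3 < Rq y\<close>, so \<open>Qq l\<close> decreases on all of
  \<open>(0, pi)\<close> and the supremum is its limit at \<open>0+\<close>, where \<open>Aq\<close>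
  tends to 1 and \<open>Bq\<close> to 0.\<close>

lemma q2_eq_small:
  assumes "0 \<le> l" "l \<le> 1 / 3"
  shows "q2 l = 1 - l"
proof -
  have lim: "(Qq l \<longlongrightarrow> (1 - l) ^ 2) (at_right 0)"
  proof -
    have "(Aq \<longlongrightarrow> 1) (at_right 0)" "(Bq \<longlongrightarrow> 0) (at_right 0)"
      unfolding Aq_def Bq_def by real_asymp+
    then have "(Qq l \<longlongrightarrow> (l - 1) ^ 2 + 0 ^ 2) (at_right 0)"
      unfolding Qq_def by (intro tendsto_intros)
    then show ?thesis by (simp add: power2_commute)
  qed
  have near: "Qq l y \<le> (1 - l) ^ 2" if y: "0 < y" "y < pi" for y
  proof (rule tendsto_lowerbound[OF lim])
    have "\<forall>\<^sub>F t in at_right 0. 0 < t \<and> t < y"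
      using y by (auto simp: eventually_at_right_field)
    then show "\<forall>\<^sub>F t in at_right 0. Qq l y \<le> Qq l t"
    proof eventually_elim
      case (elim t)
      then show ?case using y assms Rq_gt[of t] by (intro less_imp_le Qq_less_decreasing) auto
    qed
  qed simp
  have "Qq l y \<le> (1 - l) ^ 2" if y: "0 < y" for y
  proof (cases "y < pi")
    case False
    then have "Qq l y \<le> Qq l (pi / 2)"
      using Qq_le_beyond_pi[of l y] Qq_pi_half_ge[of l] assms one_third_less by simp
    also have "\<dots> \<le> (1 - l) ^ 2" by (rule near) auto
    finally show ?thesis .
  qed (use near y in auto)
  then have "q2 l \<le> 1 - l"
    using assms by (intro q2_le real_le_lsqrt) auto
  moreover have "1 - l \<le> q2 l"
  proof (rule tendsto_upperbound)
    have "((\<lambda>y. sqrt (Qq l y)) \<longlongrightarrow> sqrt ((1 - l) ^ 2)) (at_right 0)"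
      using lim by (rule tendsto_real_sqrt)
    then show "((\<lambda>y. sqrt (Qq l y)) \<longlongrightarrow> 1 - l) (at_right 0)" using assms by simp
    show "\<forall>\<^sub>F y in at_right 0. sqrt (Qq l y) \<le> q2 l"
      by (auto simp: eventually_at_right_field intro!: exI[of _ 1] sqrt_Qq_le_q2)
  qed simp
  ultimately show ?thesis by simp
qed

section \<open>Monotonicity in the parameter \<open>l\<close>\<close>

lemma Bq_pos:
  assumes "0 < y"
  shows "0 < Bq y"
proof -
  have "sin y * cos y < y"
  proof (cases "y < pi")
    case True
    then have s: "sin y > 0" "y * cos y < sin y" using assms mult_cos_less_sin
      by (auto simp: sin_gt_zero)
    \<comment> \<open>This is \<open>y * cos y < sin y\<close> multiplied by \<open>sin y\<close>;
      with \<open>sin y \<le> y\<close> a factor \<open>y\<close> then cancels.\<close>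
    have "y * (sin y * cos y) < sin y ^ 2"
      using mult_strict_left_mono[OF s(2,1)] by (simp add: power2_eq_square mult_ac)
    also have "\<dots> \<le> y * y"
      using sin_x_le_x[of y] assms s by (simp add: power2_eq_square mult_mono)
    finally show ?thesis using assms by simp
  next
    case False
    have "\<bar>sin y * cos y\<bar> \<le> 1"
      unfolding abs_mult by (rule mult_le_one) auto
    then show ?thesis using False pi_gt3 by linarith
  qed
  then show ?thesis using assms by (simp add: Bq_def)
qed

text \<open>The point \<open>z\<close> maximises for the smaller parameter: \<open>q2 l\<close> is
  exact there, while \<open>q2 l'\<close> is bounded below, which is the direction needed.\<close>

lemma q2_plus_less:
  assumes "1 / 3 < l" "l < l'" "l' \<le> 4 / pi ^ 2"
  shows "l + q2 l < l' + q2 l'"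
proof -
  obtain z where z: "0 < z" "z \<le> pi / 2" "Rq z = l" using Rq_surj[of l] assms by auto
  define a b c where "a = l - Aq z" and "b = l' - Aq z" and "c = Bq z"
  have c: "c > 0" using Bq_pos z by (simp add: c_def)
  have "sqrt (a ^ 2 + c ^ 2) < (b - a) + sqrt (b ^ 2 + c ^ 2)"
  proof (rule real_less_lsqrt[OF less_imp_le])
    have b: "\<bar>b\<bar> < sqrt (b ^ 2 + c ^ 2)" using c by (intro real_less_rsqrt) simp
    have ba: "b - a > 0" using assms by (simp add: a_def b_def)
    show "0 < (b - a) + sqrt (b ^ 2 + c ^ 2)" using b ba by linarith
    \<comment> \<open>The product on the right is positive because \<open>c > 0\<close> makes the
      root exceed \<open>\<bar>b\<bar>\<close>.\<close>
    have "((b - a) + sqrt (b ^ 2 + c ^ 2)) ^ 2 - (a ^ 2 + c ^ 2)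
       = 2 * (b - a) * (b + sqrt (b ^ 2 + c ^ 2))"
      using real_sqrt_pow2[of "b ^ 2 + c ^ 2"] by (simp add: power2_sum) algebra
    moreover have "2 * (b - a) * (b + sqrt (b ^ 2 + c ^ 2)) > 0"
      using b ba by (intro mult_pos_pos) linarith+
    ultimately show "a ^ 2 + c ^ 2 < ((b - a) + sqrt (b ^ 2 + c ^ 2)) ^ 2" by linarith
  qed
  then have "l + sqrt (Qq l z) < l' + sqrt (Qq l' z)"
    by (simp add: Qq_def a_def b_def c_def)
  also have "\<dots> \<le> l' + q2 l'" using sqrt_Qq_le_q2 z by simp
  finally show ?thesis using q2_eq_of_Rq_eq[of l z] assms z by simp
qed

text \<open>\<open>Aq\<close> decreases up to \<open>pi / 2\<close>. Hence every
  \<open>l \<le> 4 / pi ^ 2\<close> lies below \<open>Aq y\<close>, and raising \<open>l\<close>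
  shrinks the distance \<open>\<bar>l - Aq y\<bar>\<close>.\<close>

lemma Aq_ge:
  assumes "0 < y" "y \<le> pi / 2"
  shows "4 / pi ^ 2 \<le> Aq y"
proof -
  have "Aq (pi / 2) \<le> Aq y"
  proof (rule DERIV_nonpos_imp_nonincreasing[OF assms(2)])
    fix t :: real
    assume t: "y \<le> t" "t \<le> pi / 2"
    have "(Aq has_real_derivative - (2 * sin t * (sin t - t * cos t) / t ^ 3)) (at t)"
      using t assms by (intro Aq_has_derivative) simp
    moreover have "- (2 * sin t * (sin t - t * cos t) / t ^ 3) \<le> 0"
      using t assms mult_cos_less_sin[of t] sin_gt_zero[of t] by simp
    ultimately show "\<exists>d. (Aq has_real_derivative d) (at t) \<and> d \<le> 0" by blast
  qed
  then show ?thesis by (simp add: Aq_pi_half)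
qed

text \<open>Now \<open>z\<close> maximises for the larger parameter \<open>l'\<close>. For
  \<open>l' \<le> 1 / 3\<close> the formula \<open>1 - l\<close> is used instead.\<close>

lemma q2_strict_antimono:
  assumes "0 \<le> l" "l < l'" "l' \<le> 4 / pi ^ 2"
  shows "q2 l' < q2 l"
proof (cases "l' \<le> 1 / 3")
  case True
  then show ?thesis using assms by (simp add: q2_eq_small)
next
  case False
  then obtain z where z: "0 < z" "z \<le> pi / 2" "Rq z = l'" using Rq_surj[of l'] assms by auto
  have "(Aq z - l') ^ 2 < (Aq z - l) ^ 2"
    using Aq_ge[OF z(1,2)] assms by (intro power_strict_mono) auto
  then have "sqrt (Qq l' z) < sqrt (Qq l z)"
    by (simp add: Qq_def power2_commute)
  also have "\<dots> \<le> q2 l" using sqrt_Qq_le_q2 z by simp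
  finally show ?thesis using q2_eq_of_Rq_eq[of l' z] assms z by simp
qed

section \<open>Formula at \<open>theta2\<close>, least value of \<open>q2\<close> and the supremum
  of \<open>(x - sin x) / x ^ 2\<close>\<close>

lemma q2_eq_theta2:
  assumes "1 / 3 < l" "l \<le> 4 / pi ^ 2"
  shows "q2 l = sqrt (Qq l (theta2 l / 2))" and "theta2 l > 0"
proof -
  obtain z where z: "0 < z" "z \<le> pi / 2" "Rq z = l" using Rq_surj[OF assms] .
  then have "theta2 l = 2 * z"
    using assms by (intro theta2_eqI) (simp_all add: theta2_root_iff)
  then show "q2 l = sqrt (Qq l (theta2 l / 2))" "theta2 l > 0"
    using q2_eq_of_Rq_eq[of l z] z assms by simp_all
qed

text \<open>At \<open>pi / 2\<close> the term \<open>Bq\<close> alone contributes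
  \<open>2 / pi\<close>, whatever \<open>l\<close> is.\<close>

lemma q2_ge: "2 / pi \<le> q2 l"
proof -
  have "2 / pi \<le> sqrt (Qq l (pi / 2))"
    using Qq_pi_half_ge[of l] by (intro real_le_rsqrt) (simp add: power_divide)
  also have "\<dots> \<le> q2 l" by (rule sqrt_Qq_le_q2) simp
  finally show ?thesis .
qed

lemma q2_at_four_div_pi_square: "q2 (4 / pi ^ 2) = 2 / pi"
  using q2_eq_of_Rq_eq[of "4 / pi ^ 2" "pi / 2"]
  by (simp add: Rq_pi_half Qq_def Aq_pi_half Bq_pi_half)

text \<open>Dropping the first square bounds \<open>Bq\<close> by
  \<open>q2 (4 / pi ^ 2) = 2 / pi\<close>; equality holds at \<open>x = pi\<close>.\<close>

lemma SUP_x_minus_sin: "(SUP x\<in>{0<..}. (x - sin x) / x ^ 2) = 1 / pi"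
proof (rule cSup_eq_maximum)
  show "1 / pi \<in> (\<lambda>x. (x - sin x) / x ^ 2) ` {0<..}"
    by (rule image_eqI[of _ _ pi]) (auto simp: power2_eq_square)
next
  fix u assume "u \<in> (\<lambda>x::real. (x - sin x) / x ^ 2) ` {0<..}"
  then obtain x :: real where x: "x > 0" "u = (x - sin x) / x ^ 2" by auto
  have "Bq (x / 2) \<le> sqrt (Qq (4 / pi ^ 2) (x / 2))"
    unfolding Qq_def by (rule real_le_rsqrt) simp
  also have "\<dots> \<le> 2 / pi"
    using sqrt_Qq_le_q2[of "x / 2" "4 / pi ^ 2"] x by (simp add: q2_at_four_div_pi_square)
  finally have "2 * u \<le> 2 * (1 / pi)" using x by (simp add: Bq_half)
  then show "u \<le> 1 / pi" by (simp only: mult_le_cancel_left_pos zero_less_numeral)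
qed

lemma INF_q2: "(INF l\<in>{0..}. q2 l) = q2 (4 / pi ^ 2)"
proof (rule cInf_eq_minimum)
  fix u assume "u \<in> q2 ` {0..}"
  then show "q2 (4 / pi ^ 2) \<le> u"
    unfolding q2_at_four_div_pi_square using q2_ge by auto
qed auto

section \<open>Numerical bounds\<close>

lemma arctan_ge_poly:
  fixes x :: real
  assumes "0 \<le> x"
  shows "x - x ^ 3 / 3 + x ^ 5 / 5 - x ^ 7 / 7 \<le> arctan x"
proof -
  define f where "f t = arctan t - (t - t ^ 3 / 3 + t ^ 5 / 5 - t ^ 7 / 7)" for t :: real
  have "f 0 \<le> f x"
  proof (rule DERIV_nonneg_imp_nondecreasing[OF assms])
    fix t :: real
    have p: "1 + t ^ 2 > 0" by (simp add: add_pos_nonneg)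
    \<comment> \<open>The derivative of the error is the remainder of a truncated geometric
      series.\<close>
    have "inverse (1 + t ^ 2) - (1 - t ^ 2 + t ^ 4 - t ^ 6) = t ^ 8 / (1 + t ^ 2)"
      using p by (simp add: field_simps eval_nat_numeral)
    moreover have "(f has_real_derivative inverse (1 + t ^ 2) - (1 - t ^ 2 + t ^ 4 - t ^ 6)) (at t)"
      unfolding f_def by (auto intro!: derivative_eq_intros)
    moreover have "t ^ 8 / (1 + t ^ 2) \<ge> 0" using p by simp
    ultimately show "\<exists>d. (f has_real_derivative d) (at t) \<and> d \<ge> 0" by auto
  qed
  then show ?thesis by (simp add: f_def)
qed

lemma arctan_le_poly:
  fixes x :: real
  assumes "0 \<le> x"
  shows "arctan x \<le> x - x ^ 3 / 3 + x ^ 5 / 5 - x ^ 7 / 7 + x ^ 9 / 9"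
proof -
  define f where "f t = t - t ^ 3 / 3 + t ^ 5 / 5 - t ^ 7 / 7 + t ^ 9 / 9 - arctan t" for t :: real
  have "f 0 \<le> f x"
  proof (rule DERIV_nonneg_imp_nondecreasing[OF assms])
    fix t :: real
    have p: "1 + t ^ 2 > 0" by (simp add: add_pos_nonneg)
    have "1 - t ^ 2 + t ^ 4 - t ^ 6 + t ^ 8 - inverse (1 + t ^ 2) = t ^ 10 / (1 + t ^ 2)"
      using p by (simp add: field_simps eval_nat_numeral)
    moreover have "(f has_real_derivative 1 - t ^ 2 + t ^ 4 - t ^ 6 + t ^ 8 - inverse (1 + t ^ 2)) (at t)"
      unfolding f_def by (auto intro!: derivative_eq_intros)
    moreover have "t ^ 10 / (1 + t ^ 2) \<ge> 0" using p by simp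
    ultimately show "\<exists>d. (f has_real_derivative d) (at t) \<and> d \<ge> 0" by auto
  qed
  then show ?thesis by (simp add: f_def)
qed

text \<open>Machin's formula with arctangent polynomials; the minus sign at \<open>1 / 239\<close>
  calls for the opposite bound there.\<close>

lemma pi_bounds: "3.1415916 < pi" "pi < 3.1415928"
proof -
  have m: "pi = 16 * arctan (1 / 5) - 4 * arctan (1 / 239)"
    using machin by simp
  show "3.1415916 < pi"
    using arctan_ge_poly[of "1 / 5"] arctan_le_poly[of "1 / 239"] unfolding m
    by (simp add: power_divide)
  show "pi < 3.1415928"
    using arctan_le_poly[of "1 / 5"] arctan_ge_poly[of "1 / 239"] unfolding m
    by (simp add: power_divide)
qed

lemma four_div_pi_square_bounds: "0.4052 \<le> 4 / pi ^ 2" "4 / pi ^ 2 < 0.4053"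
proof -
  have "pi ^ 2 \<le> 3.1415928 ^ 2" using pi_bounds by (intro power_mono) auto
  then show "0.4052 \<le> 4 / pi ^ 2" by (simp add: field_simps power2_eq_square)
  have "3.1415916 ^ 2 \<le> pi ^ 2" using pi_bounds by (intro power_mono) auto
  then show "4 / pi ^ 2 < 0.4053" by (simp add: field_simps power2_eq_square)
qed

lemma two_div_pi_bounds: "0.636619 \<le> 2 / pi" "2 / pi < 0.636620"
  using pi_bounds by (simp_all add: field_simps)

theorem lemma3:
  shows
    "(\<forall>l. 1 / 3 < l \<and> l \<le> 4 / pi ^ 2 \<longrightarrow> (\<exists>!x. theta2_root l x))
     \<and> theta2 (4 / pi ^ 2) = pi
     \<and> (\<forall>l. 0 \<le> l \<and> l \<le> 1 / 3 \<longrightarrow> q2 l = 1 - l)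
     \<and> (\<forall>l. 1 / 3 < l \<and> l \<le> 4 / pi ^ 2 \<longrightarrow>
          q2 l = (let x = theta2 l in
            2 * sqrt (((cos x - 1 + l * x ^ 2 / 2) / x ^ 2) ^ 2 + ((x - sin x) / x ^ 2) ^ 2)))
     \<and> strict_mono_on {1 / 3<..4 / pi ^ 2} (\<lambda>l. l + q2 l)
     \<and> strict_antimono_on {0..4 / pi ^ 2} q2
     \<and> q2 (1 / 3) = 2 / 3
     \<and> (INF l\<in>{0..}. q2 l) = q2 (4 / pi ^ 2)
     \<and> q2 (4 / pi ^ 2) = 2 * (SUP x\<in>{0<..}. (x - sin x) / x ^ 2)
     \<and> 2 * (SUP x\<in>{0<..}. (x - sin x) / x ^ 2) = 2 / pi
     \<and> 0.4052 \<le> 4 / pi ^ 2 \<and> 4 / pi ^ 2 < 0.4053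
     \<and> 0.636619 \<le> 2 / pi \<and> 2 / pi < 0.636620"
proof (intro conjI allI impI)
  show "theta2 (4 / pi ^ 2) = pi"
    using one_third_less by (intro theta2_eqI) (auto simp: theta2_root_iff Rq_pi_half)
next
  fix l :: real
  assume l: "1 / 3 < l \<and> l \<le> 4 / pi ^ 2"
  then show "q2 l = (let x = theta2 l in
            2 * sqrt (((cos x - 1 + l * x ^ 2 / 2) / x ^ 2) ^ 2 + ((x - sin x) / x ^ 2) ^ 2))"
    using q2_eq_theta2[of l] sqrt_Qq_half[of "theta2 l" l] by (simp add: Let_def)
next
  show "strict_mono_on {1 / 3<..4 / pi ^ 2} (\<lambda>l. l + q2 l)"
    by (auto intro!: strict_mono_onI q2_plus_less)
  show "strict_antimono_on {0..4 / pi ^ 2} q2"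
    by (auto intro!: monotone_onI q2_strict_antimono)
qed (use ex1_theta2_root q2_eq_small INF_q2 four_div_pi_square_bounds two_div_pi_bounds in
      \<open>auto simp: q2_at_four_div_pi_square SUP_x_minus_sin\<close>)

end
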